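(* Let $A_1$ and $A_2$ be isomorphic real unital associative algebras, each with underlying vector space of elements $\mathbb{R}^n$ ($n\ge1$). Then $\mathfrak{u}^d_{A_1}$ and $\mathfrak{u}^d_{A_2}$ are the same up to a change of basis; that is, there is a nonsingular linear map $K:\mathbb{R}^n\to\mathbb{R}^n$ with $K\mathbf{1}_{A_1}=\mathbf{1}_{A_2}$ such that $$\mathfrak{u}^d_{A_1}=\{\ell\circ K : \ell\in\mathfrak{u}^d_{A_2}\},$$ where functions are identified when they agree on a neighborhood of $\mathbf{1}_{A_1}$.
   Context: All algebras are real, unital, associative, with vector space of elements $\mathbb{R}^n$, the standard topology, and the standard basis; elements are column vectors, $^T$ is transpose, and $\cdot$ is the usual dot product. For an algebra $A$ with multiplicative identity $\mathbf{1}=\mathbf{1}_A$, an uncurling metric of $A$ is a real symmetric $n\times n$ matrix $L$ such that, on some neighborhood of $\mathbf{1}$ consisting only of units (invertible elements), the differential 1-form $(Ls^{-1})\cdot \mathbf{d}s=(s^{-1})^TL\,\mathbf{d}s$ is closed, i.e. $d\big((s^{-1})^TL\,\mathbf{d}s\big)=0$. Here $s^{-1}$ is the multiplicative inverse of $s$ in $A$, $\mathbf{d}s=(dx_1,\dots,dx_n)^T$, and $d$ is the exterior derivative. The set of uncurling metrics of $A$ is a real vector space $\mathfrak{u}_A$, called the anti-rotor of $A$. Given an uncurling metric $L$ of $A$, with $\|\mathbf{1}\|^2:=\mathbf{1}\cdot\mathbf{1}$, the associated unital norm is the function, defined for $s$ in an open ball centered at $\mathbf{1}$ and devoid of non-units,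 $$\ell(s):=\exp\left(\frac{1}{\|\mathbf{1}\|^2}\int_{\mathbf{1}}^{s}\left(Lt^{-1}\right)\cdot\mathbf{d}t\right),$$ the line integral being path-independent within the ball. The set of unital norms of $A$, as $L$ ranges over $\mathfrak{u}_A$, is an abelian group under pointwise multiplication, called the dual of the anti-rotor and denoted $\mathfrak{u}^d_A$. *)

theory Defs
  imports "HOL-Analysis.Analysis"
begin

text \<open>
  A real unital associative algebra on the Euclidean space \<open>real ^ 'n\<close> is given by its
  multiplication \<open>m\<close> and its identity element \<open>e\<close>; addition, scalar multiplication, topology,
  standard basis and dot product are those of \<open>real ^ 'n\<close>.
\<close>

definition unital_algebra ::
    "(real ^ 'n \<Rightarrow> real ^ 'n \<Rightarrow> real ^ 'n) \<Rightarrow> real ^ 'n \<Rightarrow> bool" where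
  "unital_algebra m e \<longleftrightarrow>
     bilinear m \<and> (\<forall>x y z. m (m x y) z = m x (m y z)) \<and> (\<forall>x. m e x = x \<and> m x e = x)"

definition algebra_iso ::
    "(real ^ 'n \<Rightarrow> real ^ 'n \<Rightarrow> real ^ 'n) \<Rightarrow> real ^ 'n \<Rightarrow>
     (real ^ 'n \<Rightarrow> real ^ 'n \<Rightarrow> real ^ 'n) \<Rightarrow> real ^ 'n \<Rightarrow> (real ^ 'n \<Rightarrow> real ^ 'n) \<Rightarrow> bool" where
  "algebra_iso m1 e1 m2 e2 \<phi> \<longleftrightarrow>
     linear \<phi> \<and> bij \<phi> \<and> (\<forall>x y. \<phi> (m1 x y) = m2 (\<phi> x) (\<phi> y)) \<and> \<phi> e1 = e2"

definition isomorphic_algebras ::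
    "(real ^ 'n \<Rightarrow> real ^ 'n \<Rightarrow> real ^ 'n) \<Rightarrow> real ^ 'n \<Rightarrow>
     (real ^ 'n \<Rightarrow> real ^ 'n \<Rightarrow> real ^ 'n) \<Rightarrow> real ^ 'n \<Rightarrow> bool" where
  "isomorphic_algebras m1 e1 m2 e2 \<longleftrightarrow> (\<exists>\<phi>. algebra_iso m1 e1 m2 e2 \<phi>)"

definition alg_units ::
    "(real ^ 'n \<Rightarrow> real ^ 'n \<Rightarrow> real ^ 'n) \<Rightarrow> real ^ 'n \<Rightarrow> (real ^ 'n) set" where
  "alg_units m e = {s. \<exists>t. m s t = e \<and> m t s = e}"

definition alg_inv ::
    "(real ^ 'n \<Rightarrow> real ^ 'n \<Rightarrow> real ^ 'n) \<Rightarrow> real ^ 'n \<Rightarrow> real ^ 'n \<Rightarrow> real ^ 'n" where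
  "alg_inv m e s = (THE t. m s t = e \<and> m t s = e)"

text \<open>
  A differential 1-form \<open>F(s) \<bullet> ds\<close> is represented by its coefficient field \<open>F\<close>. Its exterior
  derivative \<open>\<Sum>i<j. (\<partial>\<^sub>i F\<^sub>j - \<partial>\<^sub>j F\<^sub>i) dx\<^sub>i \<and> dx\<^sub>j\<close> is given by its values on pairs of vectors.
\<close>

definition ext_deriv :: "('a::euclidean_space \<Rightarrow> 'a) \<Rightarrow> 'a \<Rightarrow> 'a \<Rightarrow> 'a \<Rightarrow> real" where
  "ext_deriv F s u v =
     frechet_derivative F (at s) u \<bullet> v - frechet_derivative F (at s) v \<bullet> u"

definition closed_form_on :: "('a::euclidean_space \<Rightarrow> 'a) \<Rightarrow> 'a set \<Rightarrow> bool" where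
  "closed_form_on F U \<longleftrightarrow>
     (\<forall>s\<in>U. F differentiable (at s)) \<and> (\<forall>s\<in>U. \<forall>u v. ext_deriv F s u v = 0)"

definition uncurling_metric ::
    "(real ^ 'n \<Rightarrow> real ^ 'n \<Rightarrow> real ^ 'n) \<Rightarrow> real ^ 'n \<Rightarrow> real ^ 'n ^ 'n \<Rightarrow> bool" where
  "uncurling_metric m e L \<longleftrightarrow>
     transpose L = L \<and>
     (\<exists>U. open U \<and> e \<in> U \<and> U \<subseteq> alg_units m e \<and>
          closed_form_on (\<lambda>s. L *v alg_inv m e s) U)"

definition anti_rotor ::
    "(real ^ 'n \<Rightarrow> real ^ 'n \<Rightarrow> real ^ 'n) \<Rightarrow> real ^ 'n \<Rightarrow> (real ^ 'n ^ 'n) set" where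
  "anti_rotor m e = {L. uncurling_metric m e L}"

text \<open>The line integral of \<open>F(t) \<bullet> dt\<close> along the path \<open>\<gamma>\<close>, in the style of
  \<open>has_contour_integral\<close>.\<close>

definition has_line_integral ::
    "('a::euclidean_space \<Rightarrow> 'a) \<Rightarrow> real \<Rightarrow> (real \<Rightarrow> 'a) \<Rightarrow> bool" where
  "has_line_integral F i \<gamma> \<longleftrightarrow>
     ((\<lambda>t. F (\<gamma> t) \<bullet> vector_derivative \<gamma> (at t within {0..1})) has_integral i) {0..1}"

text \<open>
  \<open>l\<close> is the unital norm associated with \<open>L\<close> on some open ball about \<open>e\<close> devoid of non-units: the
  integral from \<open>e\<close> to \<open>s\<close> may be taken along any piecewise continuously differentiable path in the
  ball, always with the same value. Outside the ball the values of the total function \<open>l\<close>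
  are irrelevant.
\<close>

definition unital_norm ::
    "(real ^ 'n \<Rightarrow> real ^ 'n \<Rightarrow> real ^ 'n) \<Rightarrow> real ^ 'n \<Rightarrow> real ^ 'n ^ 'n \<Rightarrow>
     (real ^ 'n \<Rightarrow> real) \<Rightarrow> bool" where
  "unital_norm m e L l \<longleftrightarrow>
     (\<exists>r>0. ball e r \<subseteq> alg_units m e \<and>
        (\<forall>s\<in>ball e r. \<exists>i.
           (\<forall>\<gamma>. valid_path \<gamma> \<and> path_image \<gamma> \<subseteq> ball e r \<and> pathstart \<gamma> = e \<and> pathfinish \<gamma> = s
                \<longrightarrow> has_line_integral (\<lambda>t. L *v alg_inv m e t) i \<gamma>) \<and>
           l s = exp (1 / (e \<bullet> e) * i)))"

definition anti_rotor_dual ::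
    "(real ^ 'n \<Rightarrow> real ^ 'n \<Rightarrow> real ^ 'n) \<Rightarrow> real ^ 'n \<Rightarrow> (real ^ 'n \<Rightarrow> real) set" where
  "anti_rotor_dual m e = {l. \<exists>L\<in>anti_rotor m e. unital_norm m e L l}"

text \<open>The class of all functions that agree with \<open>f\<close> on a neighbourhood of \<open>x\<close>.\<close>

definition germ :: "'a::topological_space \<Rightarrow> ('a \<Rightarrow> 'b) \<Rightarrow> ('a \<Rightarrow> 'b) set" where
  "germ x f = {g. \<forall>\<^sub>F s in nhds x. g s = f s}"

end

theory Submission
  imports Defs
begin

text \<open>
  The change of basis \<open>K\<close> can be any algebra isomorphism from the first algebra to the second.
  Since \<open>K\<close> carries inverses to inverses, pulling the 1-form \<open>(L s\<inverse>) \<bullet> ds\<close> of the second algebra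
  back along \<open>K\<close> gives the form \<open>(L (K s)\<inverse>) \<bullet> K ds = (K\<^sup>T L K s\<inverse>) \<bullet> ds\<close>, which is of the same
  kind in the first algebra. Pullback along a linear map preserves closedness and line integrals
  (\<open>closed_form_on_pullback\<close>, \<open>has_line_integral_pullback\<close>), so \<open>K\<^sup>T L K\<close> is again an uncurling
  metric. The one correction is the normalisation of the exponent: \<open>K\<close> need not be an isometry,
  so \<open>\<parallel>\<one>\<parallel>\<^sup>2\<close> may differ in the two algebras, and the metric has to be rescaled by the ratio of the
  two values. The rescaled metric then has \<open>\<ell> \<circ> K\<close> as a unital norm (\<open>unital_norm_transport\<close>).

  This shows that composition with \<open>K\<close> maps the second dual into the first. Applying the
  same to the inverse isomorphism shows that every element of the first dual arises in this way.
  The two sets agree even as sets of functions, before passing to germs.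
\<close>

section \<open>Pulling 1-forms back along linear maps\<close>

text \<open>
  This is the coefficient field of \<open>c\<close> times the pullback of the form \<open>F(s) \<bullet> ds\<close>: by the
  defining property of the adjoint, pairing it with \<open>v\<close> gives \<open>c * (F (K s) \<bullet> K v)\<close>.
\<close>

definition pullback_form ::
    "real \<Rightarrow> ('a::euclidean_space \<Rightarrow> 'b::euclidean_space) \<Rightarrow> ('b \<Rightarrow> 'b) \<Rightarrow> 'a \<Rightarrow> 'a" where
  "pullback_form c K F s = c *\<^sub>R adjoint K (F (K s))"

lemma pullback_form_inner:
  fixes K :: "'a::euclidean_space \<Rightarrow> 'b::euclidean_space"
  assumes "linear K"
  shows "pullback_form c K F s \<bullet> v = c * (F (K s) \<bullet> K v)"
  by (simp add: pullback_form_def adjoint_clauses[OF assms])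

text \<open>
  The second derivatives of the linear map \<open>K\<close> vanish, so the exterior derivative of the pullback
  is the pullback of the exterior derivative by the chain rule alone.
\<close>

lemma closed_form_on_pullback:
  fixes K :: "'a::euclidean_space \<Rightarrow> 'b::euclidean_space"
  assumes K: "linear K" and F: "closed_form_on F U"
  shows "closed_form_on (pullback_form c K F) (K -` U)"
proof -
  have der: "(pullback_form c K F has_derivative
      (\<lambda>h. c *\<^sub>R adjoint K (frechet_derivative F (at (K s)) (K h)))) (at s)"
    if s: "s \<in> K -` U" for s
  proof -
    have bK: "bounded_linear K" and bA: "bounded_linear (adjoint K)"
      using K by (simp_all add: linear_conv_bounded_linear[symmetric] adjoint_linear)
    have "F differentiable (at (K s))"
      using F s by (simp add: closed_form_on_def)
    then have dF: "(F has_derivative frechet_derivative F (at (K s))) (at (K s))"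
      by (simp add: frechet_derivative_works)
    have "((\<lambda>s. F (K s)) has_derivative (\<lambda>h. frechet_derivative F (at (K s)) (K h))) (at s)"
      by (rule has_derivative_compose[OF bounded_linear_imp_has_derivative[OF bK] dF])
    then show ?thesis
      unfolding pullback_form_def[abs_def]
      by (intro has_derivative_scaleR_right bounded_linear.has_derivative[OF bA])
  qed
  show ?thesis
    unfolding closed_form_on_def
  proof (intro conjI ballI allI)
    fix s assume s: "s \<in> K -` U"
    show "pullback_form c K F differentiable (at s)"
      using der[OF s] by (auto simp: differentiable_def)
    fix u v
    have "ext_deriv (pullback_form c K F) s u v = c * ext_deriv F (K s) (K u) (K v)"
      by (simp add: ext_deriv_def frechet_derivative_at[OF der[OF s], symmetric]
          adjoint_clauses[OF K] algebra_simps)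
    also have "\<dots> = 0"
      using F s by (simp add: closed_form_on_def)
    finally show "ext_deriv (pullback_form c K F) s u v = 0" .
  qed
qed

lemma closed_form_on_cong:
  assumes G: "closed_form_on G U" and U: "open U" and eq: "\<And>s. s \<in> U \<Longrightarrow> F s = G s"
  shows "closed_form_on F U"
proof -
  have der: "(F has_derivative frechet_derivative G (at s)) (at s)" if s: "s \<in> U" for s
  proof -
    have "(G has_derivative frechet_derivative G (at s)) (at s)"
      using G s by (simp add: closed_form_on_def frechet_derivative_works)
    then show ?thesis
      using U s by (rule has_derivative_transform_within_open) (simp add: eq)
  qed
  have "ext_deriv F s u v = ext_deriv G s u v" if "s \<in> U" for s u v
    by (simp add: ext_deriv_def frechet_derivative_at[OF der[OF that], symmetric])
  then show ?thesis
    using G der unfolding closed_form_on_def differentiable_def by metis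
qed

lemma vector_derivative_linear_compose:
  fixes K :: "'a::euclidean_space \<Rightarrow> 'b::euclidean_space"
  assumes "linear K" "\<gamma> differentiable (at t)"
  shows "((K \<circ> \<gamma>) has_vector_derivative K (vector_derivative \<gamma> (at t))) (at t)"
  using assms bounded_linear.has_vector_derivative[of K \<gamma> "vector_derivative \<gamma> (at t)" "at t"]
  by (simp add: linear_conv_bounded_linear vector_derivative_works o_def)

lemma valid_path_linear_compose:
  fixes K :: "'a::euclidean_space \<Rightarrow> 'b::euclidean_space"
  assumes K: "linear K" and \<gamma>: "valid_path \<gamma>"
  shows "valid_path (K \<circ> \<gamma>)"
proof -
  have bK: "bounded_linear K"
    using K by (simp add: linear_conv_bounded_linear)
  obtain S where S: "finite S" "\<gamma> C1_differentiable_on ({0..1} - S)"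
    and cont: "continuous_on {0..1} \<gamma>"
    using \<gamma> by (auto simp: valid_path_def piecewise_C1_differentiable_on_def)
  obtain D where D: "\<And>t. t \<in> {0..1} - S \<Longrightarrow> (\<gamma> has_vector_derivative D t) (at t)"
    and D_cont: "continuous_on ({0..1} - S) D"
    using S(2) unfolding C1_differentiable_on_def by blast
  have "(K \<circ> \<gamma>) C1_differentiable_on ({0..1} - S)"
    unfolding C1_differentiable_on_def
  proof (intro exI conjI ballI)
    show "((K \<circ> \<gamma>) has_vector_derivative K (D t)) (at t)" if "t \<in> {0..1} - S" for t
      unfolding o_def by (rule bounded_linear.has_vector_derivative[OF bK D[OF that]])
    show "continuous_on ({0..1} - S) (\<lambda>t. K (D t))"
      by (rule bounded_linear.continuous_on[OF bK D_cont])
  qed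
  moreover have "continuous_on {0..1} (K \<circ> \<gamma>)"
    unfolding o_def by (rule bounded_linear.continuous_on[OF bK cont])
  ultimately show ?thesis
    using S(1) by (auto simp: valid_path_def piecewise_C1_differentiable_on_def)
qed

text \<open>
  This is the substitution rule for a linear map. The integrands agree wherever \<open>\<gamma>\<close> is
  differentiable; the finitely many corners, where \<open>vector_derivative\<close> has no meaningful value, do
  not affect the integral.
\<close>

lemma has_line_integral_pullback:
  fixes K :: "'a::euclidean_space \<Rightarrow> 'b::euclidean_space"
  assumes K: "linear K" and \<gamma>: "valid_path \<gamma>" and int: "has_line_integral F i (K \<circ> \<gamma>)"
  shows "has_line_integral (pullback_form c K F) (c * i) \<gamma>"
proof -
  obtain S where S: "finite S" "\<gamma> C1_differentiable_on ({0..1} - S)"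
    using \<gamma> by (auto simp: valid_path_def piecewise_C1_differentiable_on_def)
  have "((\<lambda>t. c * (F ((K \<circ> \<gamma>) t) \<bullet> vector_derivative (K \<circ> \<gamma>) (at t within {0..1})))
      has_integral c * i) {0..1}"
    using int unfolding has_line_integral_def by (rule has_integral_mult_right)
  then show ?thesis
    unfolding has_line_integral_def
  proof (rule has_integral_spike_finite[OF S(1), rotated])
    fix t :: real assume t: "t \<in> {0..1} - S"
    have d: "\<gamma> differentiable (at t)"
      using S(2) t by (auto simp: C1_differentiable_on_eq)
    have "vector_derivative \<gamma> (at t within {0..1}) = vector_derivative \<gamma> (at t)"
      using d t by (intro vector_derivative_at_within_ivl) (auto simp: vector_derivative_works)
    moreover have "vector_derivative (K \<circ> \<gamma>) (at t within {0..1})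
        = K (vector_derivative \<gamma> (at t))"
      using t by (intro vector_derivative_at_within_ivl vector_derivative_linear_compose K d) auto
    ultimately show "pullback_form c K F (\<gamma> t) \<bullet> vector_derivative \<gamma> (at t within {0..1})
        = c * (F ((K \<circ> \<gamma>) t) \<bullet> vector_derivative (K \<circ> \<gamma>) (at t within {0..1}))"
      by (simp add: pullback_form_inner[OF K])
  qed
qed

lemma has_line_integral_cong:
  assumes "\<And>x. x \<in> path_image \<gamma> \<Longrightarrow> F x = G x"
  shows "has_line_integral F i \<gamma> \<longleftrightarrow> has_line_integral G i \<gamma>"
  unfolding has_line_integral_def
  by (rule has_integral_cong) (simp add: assms path_image_def)

section \<open>Units and inverses under an isomorphism\<close>

lemma alg_inv_eqI:
  assumes A: "unital_algebra m e" and t: "m s t = e" "m t s = e"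
  shows "alg_inv m e s = t"
  unfolding alg_inv_def
proof (rule the_equality)
  fix t' assume t': "m s t' = e \<and> m t' s = e"
  have "t' = m (m t s) t'"
    using A t by (simp add: unital_algebra_def)
  also have "\<dots> = m t (m s t')"
    using A by (simp add: unital_algebra_def)
  also have "\<dots> = t"
    using A t' by (simp add: unital_algebra_def)
  finally show "t' = t" .
qed (use t in simp)

lemma unital_algebra_one_nonzero:
  fixes e :: "real ^ 'n"
  assumes "unital_algebra m e"
  shows "e \<noteq> 0"
proof
  assume e: "e = 0"
  have "x = 0" for x :: "real ^ 'n"
  proof -
    have "x = m 0 x"
      using assms e by (metis unital_algebra_def)
    also have "\<dots> = 0"
      using assms bilinear_lzero by (auto simp: unital_algebra_def)
    finally show ?thesis .
  qed
  then have "(1 :: real ^ 'n) = 0" .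
  then show False by simp
qed

lemma algebra_iso_inv:
  assumes "algebra_iso m1 e1 m2 e2 K"
  shows "algebra_iso m2 e2 m1 e1 (inv K)"
proof -
  have K: "linear K" "bij K" "\<And>x y. K (m1 x y) = m2 (K x) (K y)" "K e1 = e2"
    using assms by (auto simp: algebra_iso_def)
  note eqI = inv_f_eq[OF bij_is_inj[OF K(2)]] and [simp] = surj_f_inv_f[OF bij_is_surj[OF K(2)]]
  have "linear (inv K)"
    by (rule linearI; rule eqI) (simp_all add: linear_add[OF K(1)] linear_scale[OF K(1)])
  moreover have "inv K (m2 x y) = m1 (inv K x) (inv K y)" for x y
    by (rule eqI) (simp add: K(3))
  moreover have "inv K e2 = e1"
    by (rule eqI) (rule K(4))
  ultimately show ?thesis
    by (simp add: algebra_iso_def bij_imp_bij_inv[OF K(2)])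
qed

lemma algebra_iso_alg_units:
  assumes "algebra_iso m1 e1 m2 e2 K"
  shows "K s \<in> alg_units m2 e2 \<longleftrightarrow> s \<in> alg_units m1 e1"
proof -
  have K: "bij K" "\<And>x y. K (m1 x y) = m2 (K x) (K y)" "K e1 = e2"
    using assms by (auto simp: algebra_iso_def)
  have eq: "m2 (K x) (K y) = e2 \<longleftrightarrow> m1 x y = e1" for x y
    using K by (metis bij_is_inj inj_eq)
  have "(\<exists>t. m2 (K s) t = e2 \<and> m2 t (K s) = e2) \<longleftrightarrow>
        (\<exists>t. m2 (K s) (K t) = e2 \<and> m2 (K t) (K s) = e2)"
    using K(1) by (metis bij_is_surj surjD)
  then show ?thesis
    by (simp add: alg_units_def eq)
qed

lemma algebra_iso_alg_inv:
  assumes A1: "unital_algebra m1 e1" and A2: "unital_algebra m2 e2"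
    and K: "algebra_iso m1 e1 m2 e2 K" and s: "s \<in> alg_units m1 e1"
  shows "alg_inv m2 e2 (K s) = K (alg_inv m1 e1 s)"
proof -
  obtain t where t: "m1 s t = e1" "m1 t s = e1"
    using s by (auto simp: alg_units_def)
  have "m2 (K s) (K t) = e2" "m2 (K t) (K s) = e2"
    using K t unfolding algebra_iso_def by metis+
  then show ?thesis
    using alg_inv_eqI[OF A2] alg_inv_eqI[OF A1 t] by simp
qed

section \<open>Transporting metrics and unital norms\<close>

text \<open>This is the Gram matrix of the bilinear form \<open>(x, y) \<mapsto> c * ((L *v K x) \<bullet> K y)\<close>.\<close>

definition pullback_metric ::
    "real \<Rightarrow> (real ^ 'n \<Rightarrow> real ^ 'n) \<Rightarrow> real ^ 'n ^ 'n \<Rightarrow> real ^ 'n ^ 'n" where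
  "pullback_metric c K L = c *\<^sub>R (transpose (matrix K) ** L ** matrix K)"

lemma transpose_pullback_metric:
  assumes "transpose L = L"
  shows "transpose (pullback_metric c K L) = pullback_metric c K L"
  by (simp add: pullback_metric_def transpose_scalar matrix_transpose_mul assms matrix_mul_assoc)

lemma pullback_metric_mult:
  assumes "linear K"
  shows "pullback_metric c K L *v x = c *\<^sub>R adjoint K (L *v K x)"
proof -
  have "transpose (matrix K) *v y = adjoint K y" for y
    using adjoint_matrix[of "matrix K"] assms by (simp add: matrix_works fun_eq_iff)
  then show ?thesis
    using assms
    by (simp add: pullback_metric_def matrix_works scaleR_matrix_vector_assoc[symmetric]
        flip: matrix_vector_mul_assoc)
qed

text \<open>
  The pullback of the form of the second algebra has the shape required in the definition of an
  uncurling metric of the first one because \<open>K\<close> commutes with inversion. The restriction to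
  units is essential: elsewhere \<open>alg_inv\<close> has no meaningful value.
\<close>

lemma pullback_form_alg_inv:
  assumes A1: "unital_algebra m1 e1" and A2: "unital_algebra m2 e2"
    and K: "algebra_iso m1 e1 m2 e2 K" and s: "s \<in> alg_units m1 e1"
  shows "pullback_metric c K L *v alg_inv m1 e1 s
       = pullback_form c K (\<lambda>s. L *v alg_inv m2 e2 s) s"
  using K by (simp add: pullback_metric_mult algebra_iso_def pullback_form_def
      algebra_iso_alg_inv[OF A1 A2 K s])

lemma uncurling_metric_pullback:
  assumes A1: "unital_algebra m1 e1" and A2: "unital_algebra m2 e2"
    and K: "algebra_iso m1 e1 m2 e2 K" and L: "uncurling_metric m2 e2 L"
  shows "uncurling_metric m1 e1 (pullback_metric c K L)"
proof -
  have lin: "linear K" and Ke: "K e1 = e2"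
    using K by (auto simp: algebra_iso_def)
  obtain U where U: "open U" "e2 \<in> U" "U \<subseteq> alg_units m2 e2"
      "closed_form_on (\<lambda>s. L *v alg_inv m2 e2 s) U"
    and sym: "transpose L = L"
    using L by (auto simp: uncurling_metric_def)
  have "open (K -` U)"
    using U(1) lin by (intro open_vimage linear_continuous_on)
      (auto simp: linear_conv_bounded_linear)
  moreover have units: "K -` U \<subseteq> alg_units m1 e1"
    using U(3) algebra_iso_alg_units[OF K] by auto
  moreover have "closed_form_on (\<lambda>s. pullback_metric c K L *v alg_inv m1 e1 s) (K -` U)"
    using closed_form_on_pullback[OF lin U(4)] \<open>open (K -` U)\<close>
  proof (rule closed_form_on_cong)
    show "pullback_metric c K L *v alg_inv m1 e1 s
        = pullback_form c K (\<lambda>s. L *v alg_inv m2 e2 s) s" if "s \<in> K -` U" for s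
      using pullback_form_alg_inv[OF A1 A2 K] units that by blast
  qed
  ultimately show ?thesis
    using U(2) Ke sym transpose_pullback_metric by (auto simp: uncurling_metric_def)
qed

text \<open>
  A small ball about \<open>e1\<close> is mapped into the given ball about \<open>e2\<close>, so path independence of the
  line integral is inherited from the second algebra: \<open>K\<close> carries admissible paths to admissible
  paths, and the integral along a path is \<open>c\<close> times the integral along its image. The value of \<open>c\<close> is the one that turns the
  factor \<open>1 / (e2 \<bullet> e2)\<close> in the exponent into \<open>1 / (e1 \<bullet> e1)\<close>.
\<close>

lemma unital_norm_transport:
  fixes e1 e2 :: "real ^ 'n"
  defines "c \<equiv> (e1 \<bullet> e1) / (e2 \<bullet> e2)"
  assumes A1: "unital_algebra m1 e1" and A2: "unital_algebra m2 e2"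
    and K: "algebra_iso m1 e1 m2 e2 K" and l: "unital_norm m2 e2 L l"
  shows "unital_norm m1 e1 (pullback_metric c K L) (l \<circ> K)"
proof -
  let ?F1 = "\<lambda>s. pullback_metric c K L *v alg_inv m1 e1 s"
  let ?F2 = "\<lambda>s. L *v alg_inv m2 e2 s"
  have lin: "linear K" and Ke: "K e1 = e2"
    using K by (auto simp: algebra_iso_def)
  obtain r2 where r2: "r2 > 0" "ball e2 r2 \<subseteq> alg_units m2 e2"
    and l2: "\<And>s. s \<in> ball e2 r2 \<Longrightarrow> \<exists>i.
        (\<forall>\<gamma>. valid_path \<gamma> \<and> path_image \<gamma> \<subseteq> ball e2 r2 \<and> pathstart \<gamma> = e2 \<and> pathfinish \<gamma> = s
             \<longrightarrow> has_line_integral ?F2 i \<gamma>) \<and>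
        l s = exp (1 / (e2 \<bullet> e2) * i)"
    using l unfolding unital_norm_def by metis
  have "open (K -` ball e2 r2)"
    using lin by (intro open_vimage linear_continuous_on)
      (auto simp: linear_conv_bounded_linear)
  then obtain r1 where r1: "r1 > 0" "ball e1 r1 \<subseteq> K -` ball e2 r2"
    using r2(1) Ke by (metis centre_in_ball openE vimageI)
  have units: "ball e1 r1 \<subseteq> alg_units m1 e1"
    using r1(2) r2(2) algebra_iso_alg_units[OF K] by blast
  show ?thesis
    unfolding unital_norm_def
  proof (rule exI[of _ r1], intro conjI ballI)
    fix s assume s: "s \<in> ball e1 r1"
    then obtain i where
      i: "\<And>\<gamma>. \<lbrakk>valid_path \<gamma>; path_image \<gamma> \<subseteq> ball e2 r2; pathstart \<gamma> = e2; pathfinish \<gamma> = K s\<rbrakk>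
             \<Longrightarrow> has_line_integral ?F2 i \<gamma>"
      and li: "l (K s) = exp (1 / (e2 \<bullet> e2) * i)"
      using r1(2) l2[of "K s"] by blast
    show "\<exists>i. (\<forall>\<gamma>. valid_path \<gamma> \<and> path_image \<gamma> \<subseteq> ball e1 r1 \<and>
            pathstart \<gamma> = e1 \<and> pathfinish \<gamma> = s \<longrightarrow> has_line_integral ?F1 i \<gamma>) \<and>
          (l \<circ> K) s = exp (1 / (e1 \<bullet> e1) * i)"
    proof (intro exI[of _ "c * i"] conjI allI impI)
      fix \<gamma> assume \<gamma>: "valid_path \<gamma> \<and> path_image \<gamma> \<subseteq> ball e1 r1 \<and>
        pathstart \<gamma> = e1 \<and> pathfinish \<gamma> = s"
      have "path_image (K \<circ> \<gamma>) \<subseteq> ball e2 r2"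
        using \<gamma> r1(2) by (auto simp: path_image_def)
      then have "has_line_integral ?F2 i (K \<circ> \<gamma>)"
        using \<gamma> Ke by (intro i valid_path_linear_compose lin)
          (auto simp: pathstart_def pathfinish_def)
      then have "has_line_integral (pullback_form c K ?F2) (c * i) \<gamma>"
        using \<gamma> by (intro has_line_integral_pullback lin) auto
      moreover have "?F1 x = pullback_form c K ?F2 x" if "x \<in> path_image \<gamma>" for x
        using pullback_form_alg_inv[OF A1 A2 K] units \<gamma> that by blast
      ultimately show "has_line_integral ?F1 (c * i) \<gamma>"
        by (subst has_line_integral_cong) auto
    next
      show "(l \<circ> K) s = exp (1 / (e1 \<bullet> e1) * (c * i))"
        using unital_algebra_one_nonzero[OF A1] li by (simp add: c_def)
    qed
  qed (use r1 units in auto)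
qed

lemma anti_rotor_dual_compose:
  assumes A1: "unital_algebra m1 e1" and A2: "unital_algebra m2 e2"
    and K: "algebra_iso m1 e1 m2 e2 K" and l: "l \<in> anti_rotor_dual m2 e2"
  shows "l \<circ> K \<in> anti_rotor_dual m1 e1"
  using l uncurling_metric_pullback[OF A1 A2 K] unital_norm_transport[OF A1 A2 K]
  unfolding anti_rotor_dual_def anti_rotor_def by blast

theorem corollary2p6:
  fixes m1 m2 :: "real ^ 'n \<Rightarrow> real ^ 'n \<Rightarrow> real ^ 'n" and e1 e2 :: "real ^ 'n"
  assumes "unital_algebra m1 e1" and "unital_algebra m2 e2"
    and "isomorphic_algebras m1 e1 m2 e2"
  shows "\<exists>K :: real ^ 'n \<Rightarrow> real ^ 'n. linear K \<and> bij K \<and> K e1 = e2 \<and>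
           germ e1 ` anti_rotor_dual m1 e1 = germ e1 ` {l \<circ> K | l. l \<in> anti_rotor_dual m2 e2}"
proof -
  obtain K where K: "algebra_iso m1 e1 m2 e2 K"
    using assms(3) by (auto simp: isomorphic_algebras_def)
  then have props: "linear K" "bij K" "K e1 = e2"
    by (auto simp: algebra_iso_def)
  have "anti_rotor_dual m1 e1 = {l \<circ> K | l. l \<in> anti_rotor_dual m2 e2}"
  proof (intro equalityI subsetI)
    fix l assume "l \<in> anti_rotor_dual m1 e1"
    then have "l \<circ> inv K \<in> anti_rotor_dual m2 e2"
      by (rule anti_rotor_dual_compose[OF assms(2,1) algebra_iso_inv[OF K]])
    moreover have "l = (l \<circ> inv K) \<circ> K"
      using props(2) by (simp add: o_assoc[symmetric] bij_is_inj)
    ultimately show "l \<in> {l \<circ> K | l. l \<in> anti_rotor_dual m2 e2}"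
      by blast
  next
    fix l assume "l \<in> {l \<circ> K | l. l \<in> anti_rotor_dual m2 e2}"
    then show "l \<in> anti_rotor_dual m1 e1"
      using anti_rotor_dual_compose[OF assms(1,2) K] by blast
  qed
  then show ?thesis
    using props by auto
qed

end
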